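(* Under the assumptions stated in the context, the sequence $(x_n)$ is metastable with rate $\Phi'(\varepsilon,g):=\Phi(\varepsilon/3,g)$, i.e. \[ \forall\varepsilon>0\,\forall g:\mathbb{N}\to\mathbb{N}\,\exists n\le\Phi(\varepsilon/3,g)\,\forall i,j\in[n;n+g(n)]\,\big(\Vert x_i-x_j\Vert<\varepsilon\big), \] where $[n;n+g(n)]:=\{n,n+1,\ldots,n+g(n)\}$.
   Context: Let $C$ be a nonempty bounded closed convex subset of a Hilbert space $H$ with $\mathrm{diam}(C)\le M\in\mathbb{N}$, let $T:C\to C$ be a demicontinuous (strong-to-weak continuous), single-valued pseudocontraction, i.e. $\langle Tu-Tv,u-v\rangle\le\Vert u-v\Vert^2$ for all $u,v\in C$, and let $x_1,z\in C$. Let $(\lambda_n),(\theta_n)$ be sequences in $[0,1]$ with $\lambda_n(1+\theta_n)\le1$ which are acceptably paired with moduli $\varphi_1,\varphi_2,\varphi_3:\mathbb{R}\to\mathbb{N}$, $f:\mathbb{N}\to\mathbb{N}$, $n_0\in\mathbb{N}$, $\delta>0$, meaning: $(\theta_n)$ is nonincreasing and (1) $\forall\varepsilon>0\,\forall n\ge\varphi_1(\varepsilon)\,(\theta_n\le\varepsilon)$; (2) $\forall n\,(f(n+1)\ge f(n)+1)$; (3) $\forall n\ge n_0\,\big(\theta_{f(n)}\sum_{j=f(n)}^{f(n+1)}\lambda_j\ge\delta\big)$; (4) $\forall\varepsilon>0\,\forall n\ge\varphi_2(\varepsilon)\,\big((\theta_{f(n)}-\theta_{f(n+1)})\sum_{j=f(n)}^{f(n+1)}\lambda_j\le\varepsilon\big)$;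 (5) $\forall\varepsilon>0\,\forall n\ge\varphi_3(\varepsilon)\,\big(\sum_{j=f(n)}^{f(n+1)}\lambda_j^2\le\varepsilon\big)$. Let $(y_i)$ be the sequence defined by $y_i=\frac{1}{1+\theta_i}Ty_i+\frac{\theta_i}{1+\theta_i}z$, and assume it is metastable with rate $\Psi:(0,\infty)\times\mathbb{N}^\mathbb{N}\to\mathbb{N}$, i.e. $\forall\varepsilon>0\,\forall g\,\exists n\le\Psi(\varepsilon,g)\,\forall i,j\in[n;n+g(n)]\,(\Vert y_i-y_j\Vert\le\varepsilon)$. Define the Bruck iteration $x_{n+1}=(1-\lambda_n)x_n+\lambda_nTx_n+\lambda_n\theta_n(z-x_n)$. Define $\Phi(\varepsilon,g):=f(\tilde\Psi_f(\tilde\varepsilon,g_d)+n_1+d+1)$, where $\tilde\Psi_f(\varepsilon,g):=\Psi(\varepsilon,g_f)$ with $g_f(n):=f(n+g(n))-n$; $g_d(n):=d+n_1+1+\tilde g(n+n_1+d+1)$ with $\tilde g(n):=(f(n)+g(f(n)))^*-n$ and $k^*:=\max\{n\in\mathbb{N}:f(n)\le k\}$; $d:=\max\{f(k_0),\lceil\log_c(\varepsilon/8M)\rceil\}$; $n_1:=\max\{n_0,\varphi_1(\delta/2),\varphi_2(\tilde\varepsilon/4M^2),\varphi_3(\tilde\varepsilon^2/8M^2)\}$; $k_0:=\max\{\varphi_2(\varepsilon^2/6M^2),\varphi_3(\varepsilon^2/12M^2)\}$; $c:=\exp(-\delta/2)$; $\tilde\varepsilon:=\frac{1-c}{16}\varepsilon$.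 (In $\Phi(\varepsilon/3,g)$ all these quantities are computed with $\varepsilon/3$ in place of $\varepsilon$.) *)

theory Defs
  imports "HOL-Analysis.Analysis"
begin

definition weak_topology :: "'a::real_normed_vector topology" where
  "weak_topology =
     topology_generated_by {\<phi> -` U | (\<phi> :: 'a \<Rightarrow> real) U. bounded_linear \<phi> \<and> open U}"

definition demicontinuous_on :: "'a::real_normed_vector set \<Rightarrow> ('a \<Rightarrow> 'a) \<Rightarrow> bool" where
  "demicontinuous_on C T \<longleftrightarrow> continuous_map (top_of_set C) weak_topology T"

definition pseudocontraction_on :: "'a::real_inner set \<Rightarrow> ('a \<Rightarrow> 'a) \<Rightarrow> bool" where
  "pseudocontraction_on C T \<longleftrightarrow>
     (\<forall>u\<in>C. \<forall>v\<in>C. inner (T u - T v) (u - v) \<le> (norm (u - v))\<^sup>2)"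

definition acceptably_paired ::
    "(nat \<Rightarrow> real) \<Rightarrow> (nat \<Rightarrow> real) \<Rightarrow> (real \<Rightarrow> nat) \<Rightarrow> (real \<Rightarrow> nat) \<Rightarrow> (real \<Rightarrow> nat) \<Rightarrow>
     (nat \<Rightarrow> nat) \<Rightarrow> nat \<Rightarrow> real \<Rightarrow> bool" where
  "acceptably_paired l \<theta> \<phi>1 \<phi>2 \<phi>3 f n0 \<delta> \<longleftrightarrow>
     decseq \<theta> \<and>
     (\<forall>\<epsilon>>0. \<forall>n\<ge>\<phi>1 \<epsilon>. \<theta> n \<le> \<epsilon>) \<and>
     (\<forall>n. f (n + 1) \<ge> f n + 1) \<and>
     (\<forall>n\<ge>n0. \<theta> (f n) * (\<Sum>j = f n..f (n + 1). l j) \<ge> \<delta>) \<and>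
     (\<forall>\<epsilon>>0. \<forall>n\<ge>\<phi>2 \<epsilon>. (\<theta> (f n) - \<theta> (f (n + 1))) * (\<Sum>j = f n..f (n + 1). l j) \<le> \<epsilon>) \<and>
     (\<forall>\<epsilon>>0. \<forall>n\<ge>\<phi>3 \<epsilon>. (\<Sum>j = f n..f (n + 1). (l j)\<^sup>2) \<le> \<epsilon>)"

text \<open>
  The natural-number subtractions below never truncate when \<open>f (n + 1) \<ge> f n + 1\<close> for all \<open>n\<close>,
  since then \<open>f k \<ge> k\<close>; likewise the set under \<open>Max\<close> is finite, and it is nonempty
  at the arguments \<open>f n + g (f n)\<close> where it is used.
\<close>

definition rate_star :: "(nat \<Rightarrow> nat) \<Rightarrow> nat \<Rightarrow> nat" where
  "rate_star f k = Max {n. f n \<le> k}"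

definition rate_g_f :: "(nat \<Rightarrow> nat) \<Rightarrow> (nat \<Rightarrow> nat) \<Rightarrow> nat \<Rightarrow> nat" where
  "rate_g_f f g n = f (n + g n) - n"

definition rate_Psi_f ::
    "(real \<Rightarrow> (nat \<Rightarrow> nat) \<Rightarrow> nat) \<Rightarrow> (nat \<Rightarrow> nat) \<Rightarrow> real \<Rightarrow> (nat \<Rightarrow> nat) \<Rightarrow> nat" where
  "rate_Psi_f \<Psi> f \<epsilon> g = \<Psi> \<epsilon> (rate_g_f f g)"

definition rate_g_tilde :: "(nat \<Rightarrow> nat) \<Rightarrow> (nat \<Rightarrow> nat) \<Rightarrow> nat \<Rightarrow> nat" where
  "rate_g_tilde f g n = rate_star f (f n + g (f n)) - n"

definition rate_g_d :: "(nat \<Rightarrow> nat) \<Rightarrow> nat \<Rightarrow> nat \<Rightarrow> (nat \<Rightarrow> nat) \<Rightarrow> nat \<Rightarrow> nat" where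
  "rate_g_d f d n1 g n = d + n1 + 1 + rate_g_tilde f g (n + n1 + d + 1)"

definition rate_c :: "real \<Rightarrow> real" where
  "rate_c \<delta> = exp (- \<delta> / 2)"

definition rate_eps :: "real \<Rightarrow> real \<Rightarrow> real" where
  "rate_eps \<delta> \<epsilon> = (1 - rate_c \<delta>) / 16 * \<epsilon>"

definition rate_k0 :: "nat \<Rightarrow> (real \<Rightarrow> nat) \<Rightarrow> (real \<Rightarrow> nat) \<Rightarrow> real \<Rightarrow> nat" where
  "rate_k0 M \<phi>2 \<phi>3 \<epsilon> =
     max (\<phi>2 (\<epsilon>\<^sup>2 / (6 * (real M)\<^sup>2))) (\<phi>3 (\<epsilon>\<^sup>2 / (12 * (real M)\<^sup>2)))"

definition rate_n1 ::
    "nat \<Rightarrow> (real \<Rightarrow> nat) \<Rightarrow> (real \<Rightarrow> nat) \<Rightarrow> (real \<Rightarrow> nat) \<Rightarrow> nat \<Rightarrow> real \<Rightarrow> real \<Rightarrow> nat" where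
  "rate_n1 M \<phi>1 \<phi>2 \<phi>3 n0 \<delta> \<epsilon> =
     Max {n0, \<phi>1 (\<delta> / 2), \<phi>2 (rate_eps \<delta> \<epsilon> / (4 * (real M)\<^sup>2)),
          \<phi>3 ((rate_eps \<delta> \<epsilon>)\<^sup>2 / (8 * (real M)\<^sup>2))}"

definition rate_d ::
    "nat \<Rightarrow> (real \<Rightarrow> nat) \<Rightarrow> (real \<Rightarrow> nat) \<Rightarrow> (nat \<Rightarrow> nat) \<Rightarrow> real \<Rightarrow> real \<Rightarrow> nat" where
  "rate_d M \<phi>2 \<phi>3 f \<delta> \<epsilon> =
     nat (max (int (f (rate_k0 M \<phi>2 \<phi>3 \<epsilon>))) \<lceil>log (rate_c \<delta>) (\<epsilon> / (8 * real M))\<rceil>)"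

definition rate_Phi ::
    "nat \<Rightarrow> (real \<Rightarrow> nat) \<Rightarrow> (real \<Rightarrow> nat) \<Rightarrow> (real \<Rightarrow> nat) \<Rightarrow> (nat \<Rightarrow> nat) \<Rightarrow> nat \<Rightarrow> real \<Rightarrow>
     (real \<Rightarrow> (nat \<Rightarrow> nat) \<Rightarrow> nat) \<Rightarrow> real \<Rightarrow> (nat \<Rightarrow> nat) \<Rightarrow> nat" where
  "rate_Phi M \<phi>1 \<phi>2 \<phi>3 f n0 \<delta> \<Psi> \<epsilon> g =
     (let d = rate_d M \<phi>2 \<phi>3 f \<delta> \<epsilon>;
          n1 = rate_n1 M \<phi>1 \<phi>2 \<phi>3 n0 \<delta> \<epsilon>
      in f (rate_Psi_f \<Psi> f (rate_eps \<delta> \<epsilon>) (rate_g_d f d n1 g) + n1 + d + 1))"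

end

theory Submission
  imports Defs
begin

text \<open>
  Write \<open>u j = norm (x j - y i)\<close> for \<open>i = f k\<close> and \<open>j\<close> in the block from \<open>f k\<close> to \<open>f (k + 1)\<close>.
  Monotonicity of \<open>id - T\<close> gives
  \<open>(u (j+1))\<^sup>2 \<le> (1 - 2 l\<^sub>j \<theta>\<^sub>i) (u j)\<^sup>2 + 2 M l\<^sub>j (\<theta>\<^sub>i - \<theta>\<^sub>j) u j + 4 M\<^sup>2 l\<^sub>j\<^sup>2\<close>.
  Since the middle term carries a factor \<open>u j\<close>, it contributes only linearly to \<open>u\<close>; this is why a
  bound on \<open>(\<theta> (f k) - \<theta> (f (k + 1))) \<Sum> l\<^sub>j\<close> that is linear in \<open>\<epsilon>\<close> suffices in the choice of \<open>n1\<close>. Over a whole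
  block \<open>u\<close> is contracted by \<open>c = exp (-\<delta>/2)\<close> up to an error of order \<open>rate_eps\<close>. On an interval
  where \<open>y\<close> is almost constant the target \<open>y (f k)\<close> may be exchanged for \<open>y (f (k + 1))\<close>, so after
  \<open>d\<close> blocks \<open>x\<close> stays close to \<open>y\<close>.
\<close>

section \<open>Scalar recursive inequalities\<close>

text \<open>Square roots are taken step by step: \<open>1 - 2 * \<alpha> j\<close> is at most the
  square of \<open>exp (- \<alpha> j)\<close>, the linear term is absorbed by completing the square,
  and the \<open>\<gamma> j\<close> collect under one common root.\<close>

lemma perturbed_contraction_bound:
  fixes a \<alpha> \<beta> \<gamma> :: "nat \<Rightarrow> real"
  assumes step: "\<And>j. p \<le> j \<Longrightarrow> j < q \<Longrightarrow>
      (a (Suc j))\<^sup>2 \<le> (1 - 2 * \<alpha> j) * (a j)\<^sup>2 + 2 * \<beta> j * a j + \<gamma> j"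
    and a: "\<And>j. 0 \<le> a j"
    and \<alpha>: "\<And>j. p \<le> j \<Longrightarrow> j < q \<Longrightarrow> 0 \<le> \<alpha> j \<and> \<alpha> j \<le> 1"
    and \<beta>: "\<And>j. p \<le> j \<Longrightarrow> j < q \<Longrightarrow> 0 \<le> \<beta> j"
    and \<gamma>: "\<And>j. p \<le> j \<Longrightarrow> j < q \<Longrightarrow> 0 \<le> \<gamma> j"
    and "p \<le> m" "m \<le> q"
  shows "a m \<le> exp (- (\<Sum>j=p..<m. \<alpha> j)) * a p + 3 * (\<Sum>j=p..<m. \<beta> j) + sqrt (\<Sum>j=p..<m. \<gamma> j)"
  using \<open>p \<le> m\<close> \<open>m \<le> q\<close>
proof (induction m rule: dec_induct)
  case base
  then show ?case by simp
next
  case (step m)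
  define v B G where "v = exp (- (\<Sum>j=p..<m. \<alpha> j)) * a p" and "B = (\<Sum>j=p..<m. \<beta> j)"
    and "G = (\<Sum>j=p..<m. \<gamma> j)"
  define e where "e = exp (- \<alpha> m)"
  have m: "p \<le> m" "m < q" using step by auto
  have IH: "a m \<le> v + 3 * B + sqrt G" using step by (simp add: v_def B_def G_def)
  have B0: "0 \<le> B" unfolding B_def using \<beta> m by (intro sum_nonneg) auto
  have G0: "0 \<le> G" unfolding G_def using \<gamma> m by (intro sum_nonneg) auto
  have v0: "0 \<le> v" unfolding v_def using a by simp
  have \<beta>0: "0 \<le> \<beta> m" and \<gamma>0: "0 \<le> \<gamma> m" using \<beta> \<gamma> m by auto
  have e0: "0 < e" and e1: "e \<le> 1" unfolding e_def using \<alpha>[OF m] by auto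
  \<comment> \<open>This uses \<open>\<alpha> m \<le> 1\<close> and is the origin of the factor 3
    before the sum of the \<open>\<beta> j\<close>.\<close>
  have e3: "1 \<le> 3 * e"
  proof -
    have "exp (\<alpha> m) \<le> exp 1" using \<alpha>[OF m] by simp
    also have "\<dots> \<le> 3" by (rule exp_le)
    finally have "exp (\<alpha> m) * e \<le> 3 * e" using e0 by (intro mult_right_mono) auto
    then show ?thesis by (simp add: e_def flip: exp_add)
  qed
  have "1 - 2 * \<alpha> m \<le> e\<^sup>2"
    using exp_ge_add_one_self[of "- (2 * \<alpha> m)"] by (simp add: e_def flip: exp_double)
  then have "(a (Suc m))\<^sup>2 \<le> e\<^sup>2 * (a m)\<^sup>2 + 2 * \<beta> m * a m + \<gamma> m"
    using assms(1)[OF m] mult_right_mono[of "1 - 2 * \<alpha> m" "e\<^sup>2" "(a m)\<^sup>2"] by simp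
  \<comment> \<open>Since \<open>3 * e \<ge> 1\<close>, the cross term of the square dominates
    \<open>2 * \<beta> m * a m\<close>.\<close>
  also have "\<dots> \<le> (e * a m + 3 * \<beta> m)\<^sup>2 + \<gamma> m"
  proof -
    have "1 * (\<beta> m * a m) \<le> (3 * e) * (\<beta> m * a m)"
      using e3 \<beta>0 a by (intro mult_right_mono) auto
    then have "2 * \<beta> m * a m \<le> 2 * (e * a m) * (3 * \<beta> m) + (3 * \<beta> m)\<^sup>2"
      using zero_le_power2[of "3 * \<beta> m"] by (simp only: mult_ac)
    then show ?thesis by (simp add: power2_sum power_mult_distrib)
  qed
  \<comment> \<open>Only the initial-value part \<open>v\<close> keeps the damping factor
    \<open>e\<close>; on the accumulated errors it is estimated by 1.\<close>
  also have "\<dots> \<le> ((e * v + 3 * (B + \<beta> m)) + sqrt G)\<^sup>2 + \<gamma> m"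
  proof -
    have "e * a m \<le> e * (v + 3 * B + sqrt G)" using IH e0 by (intro mult_left_mono) auto
    also have "\<dots> = e * v + e * (3 * B + sqrt G)" by (simp add: algebra_simps)
    also have "\<dots> \<le> e * v + (3 * B + sqrt G)"
      using e1 e0 B0 G0 mult_right_mono[of e 1 "3 * B + sqrt G"] by simp
    finally show ?thesis using a e0 \<beta>0 by (intro add_right_mono power_mono) auto
  qed
  also have "\<dots> \<le> ((e * v + 3 * (B + \<beta> m)) + sqrt (G + \<gamma> m))\<^sup>2"
  proof -
    have "0 \<le> e * v + 3 * (B + \<beta> m)" using e0 v0 B0 \<beta>0 by simp
    then have "(e * v + 3 * (B + \<beta> m)) * sqrt G \<le> (e * v + 3 * (B + \<beta> m)) * sqrt (G + \<gamma> m)"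
      using \<gamma>0 by (intro mult_left_mono) auto
    then show ?thesis using G0 \<gamma>0 by (simp add: power2_sum algebra_simps)
  qed
  finally have "a (Suc m) \<le> (e * v + 3 * (B + \<beta> m)) + sqrt (G + \<gamma> m)"
    by (rule power2_le_imp_le) (use e0 v0 B0 \<beta>0 G0 \<gamma>0 in simp)
  moreover have "e * v = exp (- (\<Sum>j=p..<Suc m. \<alpha> j)) * a p"
    using m by (simp add: e_def v_def add.commute flip: exp_add)
  ultimately show ?case using m by (simp add: B_def G_def)
qed

text \<open>The fixed point \<open>h / (1 - c)\<close> of the affine map is reproduced by each step,
  while the other summand shrinks by \<open>c\<close>.\<close>

lemma affine_recursion_bound:
  fixes u :: "nat \<Rightarrow> real"
  assumes step: "\<And>k. p \<le> k \<Longrightarrow> k < q \<Longrightarrow> u (Suc k) \<le> c * u k + h"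
    and "u p \<le> b" "0 \<le> c" "c < 1" "0 \<le> h" "p \<le> m" "m \<le> q"
  shows "u m \<le> c ^ (m - p) * b + h / (1 - c)"
  using \<open>p \<le> m\<close> \<open>m \<le> q\<close>
proof (induction m rule: dec_induct)
  case base
  have "0 \<le> h / (1 - c)" using assms by simp
  then show ?case using \<open>u p \<le> b\<close> by simp
next
  case (step m)
  have "u (Suc m) \<le> c * u m + h" using step assms(1) by simp
  also have "\<dots> \<le> c * (c ^ (m - p) * b + h / (1 - c)) + h"
    using step \<open>0 \<le> c\<close> by (intro add_right_mono mult_left_mono) auto
  also have "\<dots> = c ^ (Suc m - p) * b + h / (1 - c)"
    using step \<open>c < 1\<close> by (simp add: Suc_diff_le field_simps)
  finally show ?case .
qed

section \<open>One step of the Bruck iteration\<close>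

text \<open>The new error is \<open>w - l *\<^sub>R b\<close>; its square is expanded, with
  \<open>inner w b\<close> bounded below and \<open>norm b\<close> bounded by \<open>2 * M\<close>.
  The target \<open>v\<close> belongs to the parameter \<open>\<tau>\<close>, the step to
  \<open>\<theta>\<close>; this mismatch produces the linear term.\<close>

lemma bruck_step_estimate:
  fixes u v z Tu Tv :: "'a::real_inner"
  assumes pc: "inner (Tu - Tv) (u - v) \<le> (norm (u - v))\<^sup>2"
    and v: "v = (1 / (1 + \<tau>)) *\<^sub>R Tv + (\<tau> / (1 + \<tau>)) *\<^sub>R z"
    and bounds: "norm (u - Tu) \<le> M" "norm (u - z) \<le> M"
    and "0 \<le> \<theta>" "\<theta> \<le> \<tau>" "\<theta> \<le> 1" "0 \<le> l"
  shows "(norm ((1 - l) *\<^sub>R u + l *\<^sub>R Tu + (l * \<theta>) *\<^sub>R (z - u) - v))\<^sup>2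
    \<le> (1 - 2 * (l * \<tau>)) * (norm (u - v))\<^sup>2 + 2 * (l * (\<tau> - \<theta>) * M) * norm (u - v) + 4 * M\<^sup>2 * l\<^sup>2"
proof -
  define w b where "w = u - v" and "b = (u - Tu) + \<theta> *\<^sub>R (u - z)"
  have "(1 + \<tau>) *\<^sub>R v = (1 + \<tau>) *\<^sub>R ((1 / (1 + \<tau>)) *\<^sub>R Tv + (\<tau> / (1 + \<tau>)) *\<^sub>R z)"
    using v by simp
  also have "\<dots> = Tv + \<tau> *\<^sub>R z"
    using assms by (simp add: scaleR_right_distrib)
  finally have Tv: "Tv = (1 + \<tau>) *\<^sub>R v - \<tau> *\<^sub>R z" by (simp add: algebra_simps)
  \<comment> \<open>The equation for \<open>v\<close> splits \<open>b\<close> into a part monotone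
    by \<open>pc\<close>, a strongly monotone part and the parameter mismatch.\<close>
  have b: "b = (w - (Tu - Tv)) + \<tau> *\<^sub>R w - (\<tau> - \<theta>) *\<^sub>R (u - z)"
    unfolding b_def w_def Tv by (simp add: algebra_simps)
  have "inner w b = (norm w)\<^sup>2 - inner (Tu - Tv) w + \<tau> * (norm w)\<^sup>2 - (\<tau> - \<theta>) * inner w (u - z)"
    unfolding b by (simp add: inner_diff_right inner_add_right inner_commute power2_norm_eq_inner)
  moreover have "(\<tau> - \<theta>) * inner w (u - z) \<le> (\<tau> - \<theta>) * (norm w * M)"
    using norm_cauchy_schwarz[of w "u - z"] mult_left_mono[OF bounds(2), of "norm w"] assms
    by (intro mult_left_mono) auto
  ultimately have "\<tau> * (norm w)\<^sup>2 - (\<tau> - \<theta>) * (norm w * M) \<le> inner w b"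
    using pc by (simp add: w_def)
  then have ip: "l * (\<tau> * (norm w)\<^sup>2 - (\<tau> - \<theta>) * (norm w * M)) \<le> l * inner w b"
    using \<open>0 \<le> l\<close> by (rule mult_left_mono)
  have "norm b \<le> norm (u - Tu) + \<theta> * norm (u - z)"
    unfolding b_def using norm_triangle_ineq[of "u - Tu" "\<theta> *\<^sub>R (u - z)"] assms by simp
  also have "\<dots> \<le> M + 1 * M" using assms by (intro add_mono mult_mono) auto
  finally have "(norm b)\<^sup>2 \<le> (2 * M)\<^sup>2" by (intro power_mono) auto
  then have nb: "l\<^sup>2 * (norm b)\<^sup>2 \<le> l\<^sup>2 * (4 * M\<^sup>2)" by (intro mult_left_mono) auto
  have iter: "(1 - l) *\<^sub>R u + l *\<^sub>R Tu + (l * \<theta>) *\<^sub>R (z - u) - v = w - l *\<^sub>R b"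
    unfolding w_def b_def by (simp add: algebra_simps)
  have "(norm (w - l *\<^sub>R b))\<^sup>2 = (norm w)\<^sup>2 - 2 * (l * inner w b) + l\<^sup>2 * (norm b)\<^sup>2"
    unfolding power2_norm_eq_inner
    by (simp add: inner_diff_left inner_diff_right inner_commute power2_eq_square)
  then show ?thesis unfolding iter w_def[symmetric] using ip nb by (simp add: algebra_simps)
qed

text \<open>Each iterate is a convex combination, with weight
  \<open>l n * (1 + \<theta> n) \<le> 1\<close>, of its predecessor and a convex combination of
  \<open>T (x n)\<close> and \<open>z\<close>. Indices start at 1, as nothing is known of
  \<open>x 0\<close>.\<close>

lemma bruck_iteration_mem:
  fixes C :: "'a::real_normed_vector set"
  assumes "convex C" "T \<in> C \<rightarrow> C" "x (1::nat) \<in> C" "z \<in> C"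
    and "\<forall>n. l n \<in> {0..1}" "\<forall>n. \<theta> n \<in> {0..1}" "\<forall>n. l n * (1 + \<theta> n) \<le> 1"
    and rec: "\<forall>n\<ge>1. x (n + 1) =
           (1 - l n) *\<^sub>R x n + l n *\<^sub>R T (x n) + (l n * \<theta> n) *\<^sub>R (z - x n)"
    and "1 \<le> n"
  shows "x n \<in> C"
  using \<open>1 \<le> n\<close>
proof (induction n rule: dec_induct)
  case base
  then show ?case using assms by simp
next
  case (step n)
  have eq: "x (Suc n) = (1 - l n * (1 + \<theta> n)) *\<^sub>R x n + (l n * (1 + \<theta> n)) *\<^sub>R
      ((1 / (1 + \<theta> n)) *\<^sub>R T (x n) + (\<theta> n / (1 + \<theta> n)) *\<^sub>R z)"
  proof -
    have "1 + \<theta> n \<noteq> 0" using assms(6) by (smt (verit) atLeastAtMost_iff)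
    then have "(l n * (1 + \<theta> n)) *\<^sub>R ((1 / (1 + \<theta> n)) *\<^sub>R T (x n) + (\<theta> n / (1 + \<theta> n)) *\<^sub>R z)
        = l n *\<^sub>R T (x n) + (l n * \<theta> n) *\<^sub>R z"
      by (simp add: scaleR_right_distrib)
    then show ?thesis using rec step by (simp add: algebra_simps)
  qed
  have pos: "0 \<le> \<theta> n" "0 \<le> l n" using assms by auto
  have "1 / (1 + \<theta> n) + \<theta> n / (1 + \<theta> n) = 1"
    using pos by (simp flip: add_divide_distrib)
  then have "(1 / (1 + \<theta> n)) *\<^sub>R T (x n) + (\<theta> n / (1 + \<theta> n)) *\<^sub>R z \<in> C"
    using assms step pos by (intro convexD) auto
  then show ?case unfolding eq using assms step pos by (intro convexD[OF \<open>convex C\<close> step.IH]) auto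
qed

section \<open>Indexing of the blocks\<close>

lemma id_le_of_strict_steps:
  fixes f :: "nat \<Rightarrow> nat"
  assumes "\<forall>n. f (n + 1) \<ge> f n + 1"
  shows "n \<le> f n"
  using assms by (intro strict_mono_imp_increasing) (auto simp: strict_mono_Suc_iff Suc_le_eq)

lemma rate_star_ge:
  assumes "\<forall>n. f (n + 1) \<ge> f n + (1::nat)" "f n \<le> k"
  shows "n \<le> rate_star f k"
proof -
  have "{n. f n \<le> k} \<subseteq> {..k}" using id_le_of_strict_steps[OF assms(1)] le_trans by blast
  then show ?thesis unfolding rate_star_def using assms
    by (intro Max_ge) (auto intro: finite_subset)
qed

text \<open>The blocks from \<open>f p\<close> on leave no gap: the witness is
  \<open>rate_star f i\<close>, and its maximality gives \<open>i < f (Suc k)\<close>.\<close>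

lemma block_of_index:
  assumes "\<forall>n. f (n + 1) \<ge> f n + (1::nat)" "f p \<le> i"
  obtains k where "p \<le> k" "f k \<le> i" "i < f (Suc k)"
proof -
  let ?k = "rate_star f i"
  have sub: "{n. f n \<le> i} \<subseteq> {..i}" using id_le_of_strict_steps[OF assms(1)] le_trans by blast
  have "f ?k \<le> i"
    using Max_in[of "{n. f n \<le> i}"] sub assms(2) unfolding rate_star_def
    by (auto intro: finite_subset)
  moreover have "i < f (Suc ?k)"
    using rate_star_ge[OF assms(1), of "Suc ?k" i] by force
  ultimately show ?thesis using rate_star_ge[OF assms] that by blast
qed

section \<open>Passage through one block\<close>

text \<open>The target stays frozen at \<open>y p\<close> for the whole block; the linear errors,
  controlled by \<open>D\<close>, and the quadratic ones, controlled by \<open>E\<close>, cost at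
  most \<open>3 / 4 * e\<close> each.\<close>

lemma bruck_block_estimate:
  fixes C :: "'a::real_inner set"
  assumes C: "bounded C" "diameter C \<le> real M" and T: "T \<in> C \<rightarrow> C" "pseudocontraction_on C T"
    and z: "z \<in> C" and x: "\<And>n. 1 \<le> n \<Longrightarrow> x n \<in> C" and M: "0 < M"
    and l: "\<forall>n. l n \<in> {0..1}" and \<theta>: "\<forall>n. \<theta> n \<in> {0..1}" and dec: "decseq \<theta>"
    and y: "y p \<in> C" "y p = (1 / (1 + \<theta> p)) *\<^sub>R T (y p) + (\<theta> p / (1 + \<theta> p)) *\<^sub>R z"
    and rec: "\<forall>n\<ge>1. x (n + 1) =
           (1 - l n) *\<^sub>R x n + l n *\<^sub>R T (x n) + (l n * \<theta> n) *\<^sub>R (z - x n)"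
    and p: "1 \<le> p" and m: "p \<le> m" "m \<le> q" and e: "0 \<le> e"
    and D: "(\<theta> p - \<theta> q) * (\<Sum>j=p..q. l j) \<le> e / (4 * (real M)\<^sup>2)"
    and E: "(\<Sum>j=p..q. (l j)\<^sup>2) \<le> e\<^sup>2 / (8 * (real M)\<^sup>2)"
  shows "norm (x m - y p) \<le> exp (- (\<Sum>j=p..<m. l j * \<theta> p)) * norm (x p - y p) + 3 / 2 * e"
proof -
  have dist: "norm (u - v) \<le> real M" if "u \<in> C" "v \<in> C" for u v
    using diameter_bounded_bound[OF C(1) that] C(2) by (simp add: dist_norm)
  let ?a = "\<lambda>j. norm (x j - y p)"
  have l0: "0 \<le> l j" "l j \<le> 1" and \<theta>0: "0 \<le> \<theta> j" "\<theta> j \<le> 1" for j using l \<theta> by auto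
  have mono: "\<theta> j \<le> \<theta> i" if "i \<le> j" for i j using dec that by (simp add: decseq_def)
  have bound: "?a m \<le> exp (- (\<Sum>j=p..<m. l j * \<theta> p)) * ?a p
      + 3 * (\<Sum>j=p..<m. l j * (\<theta> p - \<theta> j) * real M) + sqrt (\<Sum>j=p..<m. 4 * (real M)\<^sup>2 * (l j)\<^sup>2)"
  proof (rule perturbed_contraction_bound[where q = q])
    fix j assume j: "p \<le> j" "j < q"
    have xj: "x j \<in> C" using x j p by auto
    have "inner (T (x j) - T (y p)) (x j - y p) \<le> (norm (x j - y p))\<^sup>2"
      using T(2) xj y(1) by (auto simp: pseudocontraction_on_def)
    moreover have "x (Suc j) = (1 - l j) *\<^sub>R x j + l j *\<^sub>R T (x j) + (l j * \<theta> j) *\<^sub>R (z - x j)"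
      using rec j p by simp
    ultimately show "(?a (Suc j))\<^sup>2 \<le> (1 - 2 * (l j * \<theta> p)) * (?a j)\<^sup>2
        + 2 * (l j * (\<theta> p - \<theta> j) * real M) * ?a j + 4 * (real M)\<^sup>2 * (l j)\<^sup>2"
      using bruck_step_estimate[of "T (x j)" "T (y p)" "x j" "y p" "\<theta> p" z "real M" "\<theta> j" "l j"]
        y(2) dist xj z T(1) mono[OF j(1)] l0 \<theta>0 by (simp add: Pi_iff)
  next
    fix j assume "p \<le> j" "j < q"
    then show "0 \<le> l j * (\<theta> p - \<theta> j) * real M" using l0 mono by simp
  qed (use l0 \<theta>0 m in \<open>auto intro: mult_le_one\<close>)
  \<comment> \<open>Replacing \<open>\<theta> j\<close> by the smaller \<open>\<theta> q\<close>
    makes the difference constant, so that it factors out as in \<open>D\<close>.\<close>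
  have "(\<Sum>j=p..<m. l j * (\<theta> p - \<theta> j) * real M) \<le> (\<Sum>j=p..<m. l j * (\<theta> p - \<theta> q) * real M)"
    using mono m l0 by (intro sum_mono mult_right_mono mult_left_mono) auto
  also have "\<dots> \<le> (\<Sum>j=p..q. l j * (\<theta> p - \<theta> q) * real M)"
    using mono m l0 by (intro sum_mono2) auto
  also have "\<dots> = real M * ((\<theta> p - \<theta> q) * (\<Sum>j=p..q. l j))"
    by (simp add: sum_distrib_left sum_distrib_right mult_ac)
  also have "\<dots> \<le> real M * (e / (4 * (real M)\<^sup>2))" using D by (intro mult_left_mono) auto
  also have "\<dots> = e / 4 / real M" using M by (simp add: power2_eq_square)
  also have "\<dots> \<le> e / 4 / 1" using M e by (intro divide_left_mono) auto
  finally have lin: "3 * (\<Sum>j=p..<m. l j * (\<theta> p - \<theta> j) * real M) \<le> 3 / 4 * e" by simp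
  have "(\<Sum>j=p..<m. 4 * (real M)\<^sup>2 * (l j)\<^sup>2) \<le> (\<Sum>j=p..q. 4 * (real M)\<^sup>2 * (l j)\<^sup>2)"
    using m by (intro sum_mono2) auto
  also have "\<dots> = 4 * (real M)\<^sup>2 * (\<Sum>j=p..q. (l j)\<^sup>2)" by (simp add: sum_distrib_left)
  also have "\<dots> \<le> 4 * (real M)\<^sup>2 * (e\<^sup>2 / (8 * (real M)\<^sup>2))" using E by (intro mult_left_mono) auto
  also have "\<dots> = e\<^sup>2 / 2" using M by simp
  also have "\<dots> \<le> (3 / 4 * e)\<^sup>2" by (simp add: power2_eq_square)
  finally have "sqrt (\<Sum>j=p..<m. 4 * (real M)\<^sup>2 * (l j)\<^sup>2) \<le> 3 / 4 * e"
    using e by (intro real_le_lsqrt) (auto intro: sum_nonneg)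
  then show ?thesis using bound lin by simp
qed

section \<open>Metastability of the iteration\<close>

theorem theorem3p7:
  fixes C :: "'a::{real_inner, complete_space} set"
    and T :: "'a \<Rightarrow> 'a"
    and M :: nat
    and x y :: "nat \<Rightarrow> 'a" and z :: 'a
    and l \<theta> :: "nat \<Rightarrow> real"
    and \<phi>1 \<phi>2 \<phi>3 :: "real \<Rightarrow> nat"
    and f :: "nat \<Rightarrow> nat" and n0 :: nat and \<delta> :: real
    and \<Psi> :: "real \<Rightarrow> (nat \<Rightarrow> nat) \<Rightarrow> nat"
  assumes "C \<noteq> {}" and "bounded C" and "closed C" and "convex C"
    and "diameter C \<le> real M"
    and "T \<in> C \<rightarrow> C"
    and "demicontinuous_on C T"
    and "pseudocontraction_on C T"
    and "x 1 \<in> C" and "z \<in> C"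
    and "\<forall>n. l n \<in> {0..1}" and "\<forall>n. \<theta> n \<in> {0..1}"
    and "\<forall>n. l n * (1 + \<theta> n) \<le> 1"
    and "\<delta> > 0"
    and "acceptably_paired l \<theta> \<phi>1 \<phi>2 \<phi>3 f n0 \<delta>"
    and "\<forall>i. y i \<in> C \<and>
           y i = (1 / (1 + \<theta> i)) *\<^sub>R T (y i) + (\<theta> i / (1 + \<theta> i)) *\<^sub>R z"
    and "\<forall>\<epsilon>>0. \<forall>g. \<exists>n\<le>\<Psi> \<epsilon> g. \<forall>i\<in>{n..n + g n}. \<forall>j\<in>{n..n + g n}. norm (y i - y j) \<le> \<epsilon>"
    and "\<forall>n\<ge>1. x (n + 1) =
           (1 - l n) *\<^sub>R x n + l n *\<^sub>R T (x n) + (l n * \<theta> n) *\<^sub>R (z - x n)"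
  shows "\<forall>\<epsilon>>0. \<forall>g :: nat \<Rightarrow> nat.
           \<exists>n\<ge>1. n \<le> rate_Phi M \<phi>1 \<phi>2 \<phi>3 f n0 \<delta> \<Psi> (\<epsilon> / 3) g \<and>
             (\<forall>i\<in>{n..n + g n}. \<forall>j\<in>{n..n + g n}. norm (x i - x j) < \<epsilon>)"
proof (intro allI impI)
  fix \<epsilon> :: real and g :: "nat \<Rightarrow> nat"
  assume "0 < \<epsilon>"
  define \<eta> where "\<eta> = \<epsilon> / 3"
  define c where "c = rate_c \<delta>"
  define e where "e = rate_eps \<delta> \<eta>"
  define d where "d = rate_d M \<phi>2 \<phi>3 f \<delta> \<eta>"
  define n1 where "n1 = rate_n1 M \<phi>1 \<phi>2 \<phi>3 n0 \<delta> \<eta>"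
  have \<eta>: "0 < \<eta>" using \<open>0 < \<epsilon>\<close> by (simp add: \<eta>_def)
  have c: "0 < c" "c < 1" using \<open>\<delta> > 0\<close> by (auto simp: c_def rate_c_def)
  have e_eq: "e = (1 - c) / 16 * \<eta>" by (simp add: e_def c_def rate_eps_def)
  have e: "0 < e" "e \<le> \<eta> / 16" using c \<eta> by (auto simp: e_eq field_simps)
  note ap = \<open>acceptably_paired l \<theta> \<phi>1 \<phi>2 \<phi>3 f n0 \<delta>\<close>[unfolded acceptably_paired_def]
  have fS: "\<forall>n. f (n + 1) \<ge> f n + 1" and dec: "decseq \<theta>" using ap by auto
  have f_mono: "f i \<le> f j" if "i \<le> j" for i j
    by (rule lift_Suc_mono_le[of f, OF _ that]) (use fS in \<open>metis Suc_eq_plus1 add_leD1\<close>)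
  have f_id: "n \<le> f n" for n by (rule id_le_of_strict_steps[OF fS])
  have dist: "norm (u - v) \<le> real M" if "u \<in> C" "v \<in> C" for u v
    using diameter_bounded_bound[OF \<open>bounded C\<close> that] \<open>diameter C \<le> real M\<close> by (simp add: dist_norm)
  have xC: "x n \<in> C" if "1 \<le> n" for n
    by (rule bruck_iteration_mem[of C T x z l \<theta>]) (use assms that in blast)+
  have yC: "y n \<in> C" for n using assms(16) by blast
  \<comment> \<open>The counterfunction is chosen so that the interval on which \<open>y\<close> is
    stable reaches \<open>f Q\<close>, with \<open>Q\<close> defined below.\<close>
  obtain N where N: "N \<le> \<Psi> e (rate_g_f f (rate_g_d f d n1 g))"
    and yN: "\<And>i j. i \<in> {N..N + rate_g_f f (rate_g_d f d n1 g) N} \<Longrightarrow>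
      j \<in> {N..N + rate_g_f f (rate_g_d f d n1 g) N} \<Longrightarrow> norm (y i - y j) \<le> e"
    using assms(17) e(1) by meson
  \<comment> \<open>Beyond \<open>n1\<close> the moduli apply, the summand 1 keeps
    \<open>f k\<close> positive, and \<open>d\<close> further blocks are spent on contraction.
    \<open>Q\<close> is the last block starting no later than \<open>n + g n\<close>.\<close>
  define P where "P = N + n1 + d + 1"
  define n where "n = f P"
  define Q where "Q = rate_star f (n + g n)"
  have n_pos: "1 \<le> n" using f_id[of P] by (simp add: n_def P_def)
  have n_le: "n \<le> rate_Phi M \<phi>1 \<phi>2 \<phi>3 f n0 \<delta> \<Psi> (\<epsilon> / 3) g"
    using N by (auto simp: n_def P_def rate_Phi_def Let_def rate_Psi_f_def
        simp flip: \<eta>_def d_def n1_def e_def intro!: f_mono)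
  have "P \<le> Q" unfolding Q_def by (rule rate_star_ge[OF fS]) (simp add: n_def)
  \<comment> \<open>The subtraction inside \<open>rate_g_tilde\<close> yields \<open>Q - P\<close>,
    without truncation because \<open>P \<le> Q\<close>.\<close>
  then have "N + rate_g_d f d n1 g N = Q"
    by (simp add: rate_g_d_def rate_g_tilde_def Q_def n_def P_def)
  then have "N + rate_g_f f (rate_g_d f d n1 g) N \<ge> f Q"
    by (simp add: rate_g_f_def)
  then have yQ: "norm (y (f i) - y (f j)) \<le> e" if "N \<le> i" "i \<le> Q" "N \<le> j" "j \<le> Q" for i j
    using that f_id[of i] f_id[of j] f_mono[of i Q] f_mono[of j Q] by (intro yN) auto
  have close: "norm (x i - x j) < \<epsilon>" if i: "i \<in> {n..n + g n}" and j: "j \<in> {n..n + g n}" for i j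
  \<comment> \<open>The rates divide by \<open>M\<close>; for \<open>M = 0\<close> any two points of
    \<open>C\<close> coincide.\<close>
  proof (cases "M = 0")
    case True
    then show ?thesis using dist[OF xC[of i] xC[of j]] that n_pos \<open>0 < \<epsilon>\<close> by auto
  next
    case False
    then have M: "0 < M" by simp
    have block: "norm (x m - y (f k))
        \<le> exp (- (\<Sum>j=f k..<m. l j * \<theta> (f k))) * norm (x (f k) - y (f k)) + 3 / 2 * e"
      if k: "N + n1 + 1 \<le> k" and m: "f k \<le> m" "m \<le> f (k + 1)" for k m
    proof (rule bruck_block_estimate[where C = C and T = T and z = z and q = "f (k + 1)" and M = M])
      have "k \<ge> \<phi>2 (e / (4 * (real M)\<^sup>2))" "k \<ge> \<phi>3 (e\<^sup>2 / (8 * (real M)\<^sup>2))"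
        using k by (auto simp: n1_def rate_n1_def e_def)
      moreover have "0 < e / (4 * (real M)\<^sup>2)" "0 < e\<^sup>2 / (8 * (real M)\<^sup>2)" using e M by auto
      ultimately show "(\<theta> (f k) - \<theta> (f (k + 1))) * (\<Sum>j=f k..f (k + 1). l j) \<le> e / (4 * (real M)\<^sup>2)"
        "(\<Sum>j=f k..f (k + 1). (l j)\<^sup>2) \<le> e\<^sup>2 / (8 * (real M)\<^sup>2)"
        using ap by blast+
      show "1 \<le> f k" using f_id[of k] k by simp
      show "y (f k) = (1 / (1 + \<theta> (f k))) *\<^sub>R T (y (f k)) + (\<theta> (f k) / (1 + \<theta> (f k))) *\<^sub>R z"
        using assms(16) by blast
    qed (use assms dec xC yC M m e in \<open>blast | simp\<close>)+
    \<comment> \<open>The error is \<open>3 / 2 * e\<close> from the block plus \<open>e\<close> for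
      the change of target, which requires \<open>Suc k \<le> Q\<close>.\<close>
    have contr: "norm (x (f (Suc k)) - y (f (Suc k))) \<le> c * norm (x (f k) - y (f k)) + 5 / 2 * e"
      if k: "N + n1 + 1 \<le> k" "k < Q" for k
    proof -
      have kn: "k \<ge> n0" "k \<ge> \<phi>1 (\<delta> / 2)" using k by (auto simp: n1_def rate_n1_def)
      have lt: "f k < f (Suc k)" using fS by (simp add: Suc_le_eq)
      have "\<delta> \<le> \<theta> (f k) * (\<Sum>j=f k..f (Suc k). l j)" using ap kn by (metis Suc_eq_plus1)
      \<comment> \<open>The hypothesis sums over the closed block, the contraction over the
        half-open one. The endpoint costs at most \<open>\<delta> / 2\<close>, whence
        \<open>c = exp (- \<delta> / 2)\<close>.\<close>
      also have "(\<Sum>j=f k..f (Suc k). l j) = (\<Sum>j=f k..<f (Suc k). l j) + l (f (Suc k))"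
        using lt by (metis less_imp_le sum.last_plus add.commute)
      also have "\<theta> (f k) * \<dots> = (\<Sum>j=f k..<f (Suc k). l j * \<theta> (f k)) + \<theta> (f k) * l (f (Suc k))"
        by (simp add: algebra_simps sum_distrib_left)
      also have "\<theta> (f k) * l (f (Suc k)) \<le> \<delta> / 2 * 1"
      proof (rule mult_mono)
        have "\<phi>1 (\<delta> / 2) \<le> f k" using kn f_id[of k] by simp
        then show "\<theta> (f k) \<le> \<delta> / 2" using ap \<open>\<delta> > 0\<close> by (meson half_gt_zero)
      qed (use assms(11) \<open>\<delta> > 0\<close> in auto)
      finally have "exp (- (\<Sum>j=f k..<f (Suc k). l j * \<theta> (f k))) \<le> c"
        by (simp add: c_def rate_c_def)
      then have "exp (- (\<Sum>j=f k..<f (Suc k). l j * \<theta> (f k))) * norm (x (f k) - y (f k))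
          \<le> c * norm (x (f k) - y (f k))"
        by (rule mult_right_mono) simp
      then have "norm (x (f (Suc k)) - y (f k)) \<le> c * norm (x (f k) - y (f k)) + 3 / 2 * e"
        using block[of k "f (Suc k)"] k lt by simp
      moreover have "norm (y (f k) - y (f (Suc k))) \<le> e" using k by (intro yQ) auto
      ultimately show ?thesis
        using norm_triangle_ineq[of "x (f (Suc k)) - y (f k)" "y (f k) - y (f (Suc k))"] by simp
    qed
    have cd: "c ^ d * real M \<le> \<eta> / 8"
    proof -
      have "log c (\<eta> / (8 * real M)) \<le> real d"
        unfolding d_def rate_d_def c_def by linarith
      \<comment> \<open>The base lies below 1, so the larger exponent gives the smaller
        power.\<close>
      then have "c powr real d \<le> c powr log c (\<eta> / (8 * real M))"
        using c by (intro powr_mono') auto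
      also have "\<dots> = \<eta> / (8 * real M)" using c \<eta> M by simp
      finally show ?thesis using c M by (simp add: powr_realpow field_simps)
    qed
    \<comment> \<open>The bound is \<open>1 / 8 + 5 / 32\<close>: the initial distance after at
      least \<open>d\<close> contractions, and the accumulated error, where the factor
      \<open>1 - c\<close> in \<open>e\<close> cancels the geometric series.\<close>
    have at_blocks: "norm (x (f k) - y (f k)) \<le> 9 / 32 * \<eta>" if k: "P \<le> k" "k \<le> Q" for k
    proof -
      have "norm (x (f k) - y (f k)) \<le> c ^ (k - (N + n1 + 1)) * real M + 5 / 2 * e / (1 - c)"
      proof (rule affine_recursion_bound[where q = Q])
        show "norm (x (f (N + n1 + 1)) - y (f (N + n1 + 1))) \<le> real M"
          using f_id[of "N + n1 + 1"] by (intro dist xC yC) simp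
      qed (use contr c e k P_def in auto)
      also have "5 / 2 * e / (1 - c) = 5 / 32 * \<eta>" using c by (simp add: e_eq field_simps)
      also have "c ^ (k - (N + n1 + 1)) * real M \<le> c ^ d * real M"
        using c k by (intro mult_right_mono power_decreasing) (auto simp: P_def)
      finally show ?thesis using cd by simp
    qed
    \<comment> \<open>Inside a block the factor \<open>exp\<close> is only bounded by 1, and
      \<open>9 / 32 + 3 / 2 * (1 / 16) = 3 / 8\<close>.\<close>
    have near: "\<exists>k. N \<le> k \<and> k \<le> Q \<and> norm (x m - y (f k)) \<le> 3 / 8 * \<eta>" if m: "m \<in> {n..n + g n}" for m
    proof -
      obtain k where k: "P \<le> k" "f k \<le> m" "m < f (Suc k)"
        using block_of_index[OF fS, of P m] m by (auto simp: n_def)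
      have kQ: "k \<le> Q" unfolding Q_def using k m by (intro rate_star_ge[OF fS]) auto
      have "norm (x m - y (f k))
          \<le> exp (- (\<Sum>j=f k..<m. l j * \<theta> (f k))) * norm (x (f k) - y (f k)) + 3 / 2 * e"
        using k by (intro block) (auto simp: P_def)
      also have "exp (- (\<Sum>j=f k..<m. l j * \<theta> (f k))) * norm (x (f k) - y (f k))
          \<le> 1 * (9 / 32 * \<eta>)"
        using assms(11,12) at_blocks[OF k(1) kQ]
        by (intro mult_mono) (auto intro!: sum_nonneg mult_nonneg_nonneg)
      finally have "norm (x m - y (f k)) \<le> 3 / 8 * \<eta>" using e by simp
      then show ?thesis using k kQ by (intro exI[of _ k]) (auto simp: P_def)
    qed
    obtain k k' where k: "N \<le> k" "k \<le> Q" "norm (x i - y (f k)) \<le> 3 / 8 * \<eta>"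
      and k': "N \<le> k'" "k' \<le> Q" "norm (x j - y (f k')) \<le> 3 / 8 * \<eta>"
      using near i j by meson
    have "norm (x i - x j) \<le> norm (x i - y (f k)) + norm (y (f k) - y (f k')) + norm (x j - y (f k'))"
      by norm
    also have "\<dots> < \<epsilon>" using k k' yQ[of k k'] e \<eta> by (simp add: \<eta>_def)
    finally show ?thesis .
  qed
  show "\<exists>n\<ge>1. n \<le> rate_Phi M \<phi>1 \<phi>2 \<phi>3 f n0 \<delta> \<Psi> (\<epsilon> / 3) g \<and>
      (\<forall>i\<in>{n..n + g n}. \<forall>j\<in>{n..n + g n}. norm (x i - x j) < \<epsilon>)"
    using n_pos n_le close by blast
qed

end
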